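(* Let $T>0$, $r>0$, $\rho\ge 0$, $\sigma>0$, $c>0$, and let $\alpha:[0,T]\to[0,\infty)$ be a time profile satisfying the standing assumptions of the context. Let $\nu$ be a Lévy measure on $\mathbb{R}_0=\mathbb{R}\setminus\{0\}$ with finite large-jump intensity $\lambda:=\nu(\{|z|>1\})<\infty$, and let $\gamma$ be an admissible jump amplitude with constant $L_\gamma>0$ such that $$r+\rho>\sqrt{\lambda}\,L_\gamma .$$ Then there exist constants $m>1/2$, $a>0$ and $K>0$, with $K$ sufficiently large, such that the function $$\tilde u(g,t):=\alpha(t)f(g),\qquad f(g):=h(g)+K,$$ where $$h(g):=\begin{cases} m\left(\dfrac{3g^2}{4a}-\dfrac{g^4}{8a^3}\right)+\dfrac{g}{2}, & |g|\le a,\\[2ex] m|g|-\dfrac{3a}{8}m+\dfrac{g}{2}, & |g|\ge a,\end{cases}$$ is a nonnegative (global, i.e. on all of $\mathbb{R}\times[0,T]$) viscosity supersolution of the obstacle problem $$\min\left(-\mathcal{L}^{\nu}u(g,t),\ u(g,t)-u(-g,t)-\psi(g,t)\right)=0\ \text{ on }\mathbb{R}\times[0,T),\qquad u(g,T)=0\ \text{ for } g\in\mathbb{R}.$$ Moreover, $h\in C^2(\mathbb{R})$, and therefore $f\in C^2(\mathbb{R})$.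
   Context: Standing assumptions on the time profile: $\alpha\in C^1([0,T])$, $\alpha(t)\ge 0$ for all $t\in[0,T]$, $\alpha\not\equiv 0$, $\alpha(T)=0$, and $\alpha'(t)\le 0$ for all $t$. The payoff is $\psi(g,t):=g\,\alpha(t)-c$. Lévy measure: a Borel measure $\nu$ on $\mathbb{R}_0=\mathbb{R}\setminus\{0\}$ with $\int_{\mathbb{R}_0}\min(1,z^2)\,\nu(dz)<\infty$. Admissible jump amplitude: $\gamma:\mathbb{R}\times\mathbb{R}_0\to\mathbb{R}$ is admissible (with constant $L_\gamma>0$) if (1) for every $g\in\mathbb{R}$ the map $z\mapsto\gamma(g,z)$ is Borel measurable on $\mathbb{R}_0$, and for every $z\in\mathbb{R}_0$ the map $g\mapsto\gamma(g,z)$ is continuous; (2) $\int_{\mathbb{R}_0}|\gamma(x,z)-\gamma(y,z)|^2\,\nu(dz)\le L_\gamma^2|x-y|^2$ for all $x,y\in\mathbb{R}$, and $\int_{\mathbb{R}_0}|\gamma(0,z)|^2\,\nu(dz)<\infty$; (3) there is $K_1>0$ with $\sup_{0<|z|\le 1}\frac{|\gamma(g,z)|}{|z|}\le K_1(1+|g|)$ for all $g\in\mathbb{R}$; (4) there is $\epsilon\in(0,1)$ with $\limsup_{|g|\to\infty}\sup_{0<|z|\le1}\frac{|\gamma(g,z)|}{|g|}\le 1-\epsilon$. Operator (for sufficiently smooth $w$): $$\mathcal{L}^{\nu}w=w_t-\rho g\,w_g+\frac{\sigma^2}{2}w_{gg}+\int_{\mathbb{R}_0}\left[w(g+\gamma(g,z),t)-w(g,t)-\gamma(g,z)w_g(g,t)\mathbf{1}_{\{|z|\le1\}}\right]\nu(dz)-rw.$$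 Split test operator: for $\delta\in(0,1)$, $\varphi\in C^{2,1}(\mathbb{R}\times[0,T))$ ($C^2$ in $g$, $C^1$ in $t$) and a function $w$, set $$\mathcal{I}^{1,\delta}[\varphi](g,t):=\int_{0<|z|\le\delta}\left[\varphi(g+\gamma(g,z),t)-\varphi(g,t)-\gamma(g,z)\varphi_g(g,t)\right]\nu(dz),$$ $$\mathcal{I}^{2,\delta}[w,\varphi](g,t):=\int_{|z|>\delta}\left[w(g+\gamma(g,z),t)-w(g,t)-\gamma(g,z)\varphi_g(g,t)\mathbf{1}_{\{|z|\le1\}}\right]\nu(dz),$$ $$\mathcal{L}^{\nu,\delta}[\varphi,w](g,t):=\varphi_t-\rho g\,\varphi_g+\frac{\sigma^2}{2}\varphi_{gg}-r\,w(g,t)+\mathcal{I}^{1,\delta}[\varphi](g,t)+\mathcal{I}^{2,\delta}[w,\varphi](g,t).$$ Viscosity supersolution: a lower semicontinuous $v:\mathbb{R}\times[0,T]\to\mathbb{R}$ with linear growth (there is $C>0$ with $|v(g,t)|\le C(|g|+1)$ on $\mathbb{R}\times[0,T]$) is a viscosity supersolution of the obstacle problem if $v(g,T)\ge 0$ for all $g\in\mathbb{R}$ and, whenever $\varphi\in C^{2,1}(\mathbb{R}\times[0,T))$ is such that $v-\varphi$ attains a global minimum at $(g_0,t_0)\in\mathbb{R}\times[0,T)$ with $v(g_0,t_0)=\varphi(g_0,t_0)$, one has for every $\delta\in(0,1)$ $$\min\left\{-\mathcal{L}^{\nu,\delta}[\varphi,v](g_0,t_0),\ v(g_0,t_0)-v(-g_0,t_0)-\psi(g_0,t_0)\right\}\ge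 0.$$ *)

theory Defs
  imports "HOL-Analysis.Analysis"
begin

section \<open>Data of the problem\<close>

definition time_profile :: "real \<Rightarrow> (real \<Rightarrow> real) \<Rightarrow> bool" where
  "time_profile T \<alpha> \<longleftrightarrow>
     (\<exists>\<alpha>'. continuous_on {0..T} \<alpha>' \<and>
        (\<forall>t\<in>{0..T}. (\<alpha> has_real_derivative \<alpha>' t) (at t within {0..T}) \<and> \<alpha>' t \<le> 0)) \<and>
     (\<forall>t\<in>{0..T}. \<alpha> t \<ge> 0) \<and> (\<exists>t\<in>{0..T}. \<alpha> t \<noteq> 0) \<and> \<alpha> T = 0"

definition payoff :: "(real \<Rightarrow> real) \<Rightarrow> real \<Rightarrow> real \<Rightarrow> real \<Rightarrow> real" where
  "payoff \<alpha> c g t = g * \<alpha> t - c"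

text \<open>A Levy measure has the punctured line as its underlying space, so that integrals with
  respect to \<open>\<nu>\<close> never see the point 0.\<close>

definition levy_measure :: "real measure \<Rightarrow> bool" where
  "levy_measure \<nu> \<longleftrightarrow>
     sets \<nu> = sets (restrict_space borel (- {0})) \<and>
     (\<integral>\<^sup>+z. ennreal (min 1 (z\<^sup>2)) \<partial>\<nu>) < \<infinity>"

text \<open>The square integrals are taken in \<open>[0,\<infinity>]\<close>, and the suprema and the limes superior in the
  extended reals, so that each bound includes finiteness of its left-hand side. In the last
  condition the filter \<open>at_infinity\<close> is \<open>|g| \<rightarrow> \<infinity>\<close>.\<close>

definition admissible_jump :: "real measure \<Rightarrow> real \<Rightarrow> (real \<Rightarrow> real \<Rightarrow> real) \<Rightarrow> bool" where
  "admissible_jump \<nu> L \<gamma> \<longleftrightarrow>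
     (\<forall>g. \<gamma> g \<in> borel_measurable (restrict_space borel (- {0}))) \<and>
     (\<forall>z. z \<noteq> 0 \<longrightarrow> continuous_on UNIV (\<lambda>g. \<gamma> g z)) \<and>
     (\<forall>x y. (\<integral>\<^sup>+z. ennreal (\<bar>\<gamma> x z - \<gamma> y z\<bar>\<^sup>2) \<partial>\<nu>) \<le> ennreal (L\<^sup>2 * \<bar>x - y\<bar>\<^sup>2)) \<and>
     (\<integral>\<^sup>+z. ennreal (\<bar>\<gamma> 0 z\<bar>\<^sup>2) \<partial>\<nu>) < \<infinity> \<and>
     (\<exists>K\<^sub>1>0. \<forall>g. (SUP z\<in>{z. 0 < \<bar>z\<bar> \<and> \<bar>z\<bar> \<le> 1}. ereal (\<bar>\<gamma> g z\<bar> / \<bar>z\<bar>)) \<le> ereal (K\<^sub>1 * (1 + \<bar>g\<bar>))) \<and>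
     (\<exists>\<epsilon>. 0 < \<epsilon> \<and> \<epsilon> < 1 \<and>
        Limsup at_infinity (\<lambda>g. SUP z\<in>{z. 0 < \<bar>z\<bar> \<and> \<bar>z\<bar> \<le> 1}. ereal (\<bar>\<gamma> g z\<bar> / \<bar>g\<bar>)) \<le> ereal (1 - \<epsilon>))"


section \<open>Test functions and the split operator\<close>

text \<open>Functions of \<open>(g, t)\<close> are curried, and only their values for \<open>t \<in> [0,T]\<close> (test functions:
  \<open>t \<in> [0,T)\<close>) are ever used. The time derivative is taken within \<open>[0,T)\<close>: it is the right
  derivative at \<open>t = 0\<close> and the ordinary derivative for \<open>0 < t < T\<close>.\<close>

definition D_t :: "real \<Rightarrow> (real \<Rightarrow> real \<Rightarrow> real) \<Rightarrow> real \<Rightarrow> real \<Rightarrow> real" where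
  "D_t T \<phi> g t = vector_derivative (\<phi> g) (at t within {0..<T})"

definition D_g :: "(real \<Rightarrow> real \<Rightarrow> real) \<Rightarrow> real \<Rightarrow> real \<Rightarrow> real" where
  "D_g \<phi> g t = deriv (\<lambda>x. \<phi> x t) g"

definition C21 :: "real \<Rightarrow> (real \<Rightarrow> real \<Rightarrow> real) \<Rightarrow> bool" where
  "C21 T \<phi> \<longleftrightarrow>
     (\<forall>g. \<forall>t\<in>{0..<T}.
        \<phi> g differentiable (at t within {0..<T}) \<and>
        (\<lambda>x. \<phi> x t) differentiable (at g) \<and>
        (\<lambda>x. D_g \<phi> x t) differentiable (at g)) \<and>
     continuous_on (UNIV \<times> {0..<T}) (\<lambda>(g, t). \<phi> g t) \<and>
     continuous_on (UNIV \<times> {0..<T}) (\<lambda>(g, t). D_t T \<phi> g t) \<and>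
     continuous_on (UNIV \<times> {0..<T}) (\<lambda>(g, t). D_g \<phi> g t) \<and>
     continuous_on (UNIV \<times> {0..<T}) (\<lambda>(g, t). D_g (D_g \<phi>) g t)"

text \<open>For an admissible \<open>\<gamma>\<close>, a \<open>C\<^sup>2\<^sup>,\<^sup>1\<close> function \<open>\<phi>\<close> and a semicontinuous \<open>w\<close> of linear growth
  both integrands below are \<open>\<nu>\<close>-integrable, so the convention that the Bochner integral of a
  non-integrable function is 0 plays no role.\<close>

definition I1 :: "real measure \<Rightarrow> (real \<Rightarrow> real \<Rightarrow> real) \<Rightarrow> real \<Rightarrow>
    (real \<Rightarrow> real \<Rightarrow> real) \<Rightarrow> real \<Rightarrow> real \<Rightarrow> real" where
  "I1 \<nu> \<gamma> \<delta> \<phi> g t =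
     (LINT z:{z. 0 < \<bar>z\<bar> \<and> \<bar>z\<bar> \<le> \<delta>}|\<nu>. \<phi> (g + \<gamma> g z) t - \<phi> g t - \<gamma> g z * D_g \<phi> g t)"

definition I2 :: "real measure \<Rightarrow> (real \<Rightarrow> real \<Rightarrow> real) \<Rightarrow> real \<Rightarrow>
    (real \<Rightarrow> real \<Rightarrow> real) \<Rightarrow> (real \<Rightarrow> real \<Rightarrow> real) \<Rightarrow> real \<Rightarrow> real \<Rightarrow> real" where
  "I2 \<nu> \<gamma> \<delta> w \<phi> g t =
     (LINT z:{z. \<bar>z\<bar> > \<delta>}|\<nu>.
        w (g + \<gamma> g z) t - w g t - \<gamma> g z * D_g \<phi> g t * indicator {z. \<bar>z\<bar> \<le> 1} z)"

definition split_op :: "real \<Rightarrow> real \<Rightarrow> real \<Rightarrow> real \<Rightarrow> real measure \<Rightarrow> (real \<Rightarrow> real \<Rightarrow> real) \<Rightarrow> real \<Rightarrow>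
    (real \<Rightarrow> real \<Rightarrow> real) \<Rightarrow> (real \<Rightarrow> real \<Rightarrow> real) \<Rightarrow> real \<Rightarrow> real \<Rightarrow> real" where
  "split_op T r \<rho> \<sigma> \<nu> \<gamma> \<delta> \<phi> w g t =
     D_t T \<phi> g t - \<rho> * g * D_g \<phi> g t + \<sigma>\<^sup>2 / 2 * D_g (D_g \<phi>) g t - r * w g t
     + I1 \<nu> \<gamma> \<delta> \<phi> g t + I2 \<nu> \<gamma> \<delta> w \<phi> g t"


section \<open>Viscosity supersolutions of the obstacle problem\<close>

definition lsc_on :: "'a::topological_space set \<Rightarrow> ('a \<Rightarrow> real) \<Rightarrow> bool" where
  "lsc_on S v \<longleftrightarrow> (\<forall>x\<in>S. \<forall>y<v x. eventually (\<lambda>x'. y < v x') (at x within S))"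

definition linear_growth :: "real \<Rightarrow> (real \<Rightarrow> real \<Rightarrow> real) \<Rightarrow> bool" where
  "linear_growth T v \<longleftrightarrow> (\<exists>C>0. \<forall>g. \<forall>t\<in>{0..T}. \<bar>v g t\<bar> \<le> C * (\<bar>g\<bar> + 1))"

definition viscosity_supersolution :: "real \<Rightarrow> real \<Rightarrow> real \<Rightarrow> real \<Rightarrow> real measure \<Rightarrow>
    (real \<Rightarrow> real \<Rightarrow> real) \<Rightarrow> (real \<Rightarrow> real \<Rightarrow> real) \<Rightarrow> (real \<Rightarrow> real \<Rightarrow> real) \<Rightarrow> bool" where
  "viscosity_supersolution T r \<rho> \<sigma> \<nu> \<gamma> \<psi> v \<longleftrightarrow>
     lsc_on (UNIV \<times> {0..T}) (\<lambda>(g, t). v g t) \<and>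
     linear_growth T v \<and>
     (\<forall>g. v g T \<ge> 0) \<and>
     (\<forall>\<phi> g\<^sub>0 t\<^sub>0. C21 T \<phi> \<and> t\<^sub>0 \<in> {0..<T} \<and>
        (\<forall>g. \<forall>t\<in>{0..<T}. v g\<^sub>0 t\<^sub>0 - \<phi> g\<^sub>0 t\<^sub>0 \<le> v g t - \<phi> g t) \<and> v g\<^sub>0 t\<^sub>0 = \<phi> g\<^sub>0 t\<^sub>0 \<longrightarrow>
        (\<forall>\<delta>. 0 < \<delta> \<and> \<delta> < 1 \<longrightarrow>
           min (- split_op T r \<rho> \<sigma> \<nu> \<gamma> \<delta> \<phi> v g\<^sub>0 t\<^sub>0)
               (v g\<^sub>0 t\<^sub>0 - v (- g\<^sub>0) t\<^sub>0 - \<psi> g\<^sub>0 t\<^sub>0) \<ge> 0))"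


section \<open>The candidate supersolution\<close>

text \<open>For \<open>a > 0\<close> the two formulas agree at \<open>|g| = a\<close>.\<close>

definition h_fun :: "real \<Rightarrow> real \<Rightarrow> real \<Rightarrow> real" where
  "h_fun m a g =
     (if \<bar>g\<bar> \<le> a then m * (3 * g\<^sup>2 / (4 * a) - g ^ 4 / (8 * a ^ 3)) + g / 2
      else m * \<bar>g\<bar> - 3 * a / 8 * m + g / 2)"

definition f_fun :: "real \<Rightarrow> real \<Rightarrow> real \<Rightarrow> real \<Rightarrow> real" where
  "f_fun m a K g = h_fun m a g + K"

definition C2_real :: "(real \<Rightarrow> real) \<Rightarrow> bool" where
  "C2_real u \<longleftrightarrow> u C1_differentiable_on UNIV \<and> deriv u C1_differentiable_on UNIV"

end

theory Submission
  imports Defs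
begin

text \<open>The candidate is \<open>u(g, t) = \<alpha>(t) (h(g) + K)\<close>, where \<open>h\<close> is a \<open>C\<^sup>2\<close> smoothing of
  \<open>m |g| + g / 2\<close>. The even part of \<open>h\<close> cancels in \<open>u(g, t) - u(- g, t) = \<alpha>(t) g\<close>, so the obstacle
  inequality holds with the slack \<open>c\<close> everywhere, for all parameters.

  For the equation, let \<open>\<phi>\<close> touch \<open>u\<close> from below at \<open>(g, t)\<close>. As \<open>u\<close> is \<open>C\<^sup>2\<close> in \<open>g\<close> and \<open>C\<^sup>1\<close> in
  \<open>t\<close>, all terms of the split operator of \<open>\<phi>\<close> are at most those of \<open>u\<close>, and the time derivative is
  nonpositive because \<open>\<alpha>' \<le> 0 \<le> h + K\<close> (\<open>touching_derivatives\<close>, \<open>split_op_touching_le\<close>). After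
  factoring out \<open>\<alpha>(t) \<ge> 0\<close> it remains to show, for \<open>f = h + K\<close>,
  \<open>\<sigma>\<^sup>2 / 2 f'' - \<rho> g f' - r f + J \<le> 0\<close>, where \<open>J\<close> bounds the compensated jump integral of \<open>f\<close>.

  The jump integral is estimated in two parts (\<open>jump_part_domination\<close>). Small jumps: for bounded \<open>g\<close> the
  bound on \<open>f''\<close> and the square integrability of \<open>\<gamma>\<close> give a constant; for large \<open>|g|\<close> the jump is a
  strict fraction of \<open>|g|\<close>, so it stays in the region where \<open>f\<close> is affine and the compensated increment
  is 0. Large jumps: \<open>f\<close> has Lipschitz constant \<open>m + 1/2\<close>, and Cauchy--Schwarz bounds the integral of
  \<open>|\<gamma>(g, z)|\<close> over \<open>|z| > 1\<close> by \<open>sqrt \<lambda> L |g|\<close> plus a constant. On the other side, discount and drift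
  together contribute at least \<open>(r + \<rho>) (m - 1/2) |g| + r K\<close> up to a constant. Since
  \<open>r + \<rho> > sqrt \<lambda> L\<close>, the inequality \<open>(r + \<rho>) (m - 1/2) \<ge> sqrt \<lambda> L (m + 1/2)\<close> holds for large \<open>m\<close>;
  this settles the linear growth, and a large \<open>K\<close> then absorbs all constants
  (\<open>stationary_inequality\<close>).\<close>

section \<open>Regularity of the candidate\<close>

text \<open>The candidate and its derivative are glued from an affine piece, a polynomial piece and another
  affine piece; this is applied at each of the two junctions \<open>- a\<close> and \<open>a\<close>.\<close>
lemma has_real_derivative_glue:
  fixes p q p' q' :: "real \<Rightarrow> real"
  assumes "\<And>x. x \<le> b \<Longrightarrow> (p has_real_derivative p' x) (at x)"
    and "\<And>x. b \<le> x \<Longrightarrow> (q has_real_derivative q' x) (at x)"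
    and "p b = q b" and "p' b = q' b"
  shows "((\<lambda>x. if x \<le> b then p x else q x) has_real_derivative (if x \<le> b then p' x else q' x)) (at x)"
proof -
  have cl: "closure {..b} \<inter> closure {b..} = {b}"
    by auto
  have "((\<lambda>x. if x \<in> {..b} then p x else q x) has_vector_derivative
      (if x \<in> {..b} then p' x else q' x)) (at x within UNIV)"
  proof (rule has_vector_derivative_If_within_closures[where T = "{b..}"])
    show "(p has_vector_derivative p' x) (at x within {..b} \<union> (closure {..b} \<inter> closure {b..}))"
      if "x \<in> {..b} \<union> (closure {..b} \<inter> closure {b..})"
      unfolding cl
      by (rule has_vector_derivative_at_within)
         (use that cl assms(1) in \<open>auto simp flip: has_real_derivative_iff_has_vector_derivative\<close>)
    show "(q has_vector_derivative q' x) (at x within {b..} \<union> (closure {..b} \<inter> closure {b..}))"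
      if "x \<in> {b..} \<union> (closure {..b} \<inter> closure {b..})"
      unfolding cl
      by (rule has_vector_derivative_at_within)
         (use that cl assms(2) in \<open>auto simp flip: has_real_derivative_iff_has_vector_derivative\<close>)
    show "p x = q x" "p' x = q' x" if "x \<in> closure {..b}" "x \<in> closure {b..}"
    proof -
      have "x = b" using that by simp
      then show "p x = q x" "p' x = q' x" using assms(3,4) by auto
    qed
  qed auto
  then show ?thesis
    by (simp add: has_real_derivative_iff_has_vector_derivative)
qed

definition h_slope :: "real \<Rightarrow> real \<Rightarrow> real \<Rightarrow> real" where
  "h_slope m a g =
     (if \<bar>g\<bar> \<le> a then m * (3 * g / (2 * a) - g ^ 3 / (2 * a ^ 3)) + 1 / 2
      else m * sgn g + 1 / 2)"

text \<open>Taking the maximum with 0 writes the second derivative of \<open>h\<close>, which is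
  \<open>3 m / (2 a) (1 - (g / a)\<^sup>2)\<close> for \<open>|g| \<le> a\<close> and 0 elsewhere, as one visibly continuous formula.\<close>
definition h_curv :: "real \<Rightarrow> real \<Rightarrow> real \<Rightarrow> real" where
  "h_curv m a g = 3 * m / (2 * a) * max 0 (1 - (g / a)\<^sup>2)"

lemma h_slope_pieces:
  assumes "a > 0"
  shows "h_slope m a g =
    (if g \<le> - a then - m + 1 / 2
     else if g \<le> a then m * (3 * g / (2 * a) - g ^ 3 / (2 * a ^ 3)) + 1 / 2
     else m + 1 / 2)"
proof -
  consider "g < - a" | "g = - a" | "- a < g" "g \<le> a" | "a < g" by linarith
  then show ?thesis
    using assms by cases (auto simp: h_slope_def sgn_if field_simps power_numeral_reduce)
qed

lemma h_fun_deriv: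
  assumes "a > 0"
  shows "(h_fun m a has_real_derivative h_slope m a g) (at g)"
proof -
  let ?l = "\<lambda>g::real. - m * g - 3 * a / 8 * m + g / 2" and ?r = "\<lambda>g::real. m * g - 3 * a / 8 * m + g / 2"
  let ?p = "\<lambda>g::real. m * (3 * g\<^sup>2 / (4 * a) - g ^ 4 / (8 * a ^ 3)) + g / 2"
  let ?p' = "\<lambda>g::real. m * (3 * g / (2 * a) - g ^ 3 / (2 * a ^ 3)) + 1 / 2"
  have dp: "(?p has_real_derivative ?p' x) (at x)" for x
    using assms by (auto intro!: derivative_eq_intros simp: field_simps power_numeral_reduce)
  have h: "h_fun m a = (\<lambda>g. if g \<le> - a then ?l g else if g \<le> a then ?p g else ?r g)"
  proof
    fix x
    consider "x < - a" | "x = - a" | "- a < x" "x \<le> a" | "a < x" by linarith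
    then show "h_fun m a x = (if x \<le> - a then ?l x else if x \<le> a then ?p x else ?r x)"
      using assms by cases (auto simp: h_fun_def field_simps power_numeral_reduce)
  qed
  have s: "h_slope m a g = (if g \<le> - a then - m + 1 / 2 else if g \<le> a then ?p' g else m + 1 / 2)"
    by (rule h_slope_pieces[OF assms])
  show ?thesis
    unfolding h s using assms
    by (intro has_real_derivative_glue dp)
       (auto intro!: derivative_eq_intros simp: field_simps power_numeral_reduce)
qed

lemma h_slope_deriv:
  assumes "a > 0"
  shows "(h_slope m a has_real_derivative h_curv m a g) (at g)"
proof -
  let ?p' = "\<lambda>g::real. m * (3 * g / (2 * a) - g ^ 3 / (2 * a ^ 3)) + 1 / 2"
  let ?p'' = "\<lambda>g::real. 3 * m / (2 * a) * (1 - (g / a)\<^sup>2)"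
  have dp: "(?p' has_real_derivative ?p'' x) (at x)" for x
    using assms by (auto intro!: derivative_eq_intros simp: field_simps power_numeral_reduce)
  have s: "h_slope m a = (\<lambda>g. if g \<le> - a then - m + 1 / 2 else if g \<le> a then ?p' g else m + 1 / 2)"
    by (rule ext) (rule h_slope_pieces[OF assms])
  have inside: "(g / a)\<^sup>2 \<le> 1 \<longleftrightarrow> \<bar>g\<bar> \<le> a" and edge: "(g / a)\<^sup>2 = 1 \<longleftrightarrow> a = \<bar>g\<bar>"
    using assms by (simp_all add: abs_square_le_1 abs_square_eq_1)
  have c: "h_curv m a g = (if g \<le> - a then 0 else if g \<le> a then ?p'' g else 0)"
  proof (cases "\<bar>g\<bar> < a")
    case True
    then have "max 0 (1 - (g / a)\<^sup>2) = 1 - (g / a)\<^sup>2" using inside by simp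
    then show ?thesis using True by (auto simp: h_curv_def)
  next
    case False
    then have "1 \<le> (g / a)\<^sup>2" using inside edge by linarith
    then show ?thesis using False edge by (auto simp: h_curv_def)
  qed
  show ?thesis
    unfolding s c using assms
    by (intro has_real_derivative_glue dp)
       (auto intro!: derivative_eq_intros simp: field_simps power_numeral_reduce)
qed

lemma h_curv_continuous: "a > 0 \<Longrightarrow> continuous_on UNIV (h_curv m a)"
  unfolding h_curv_def by (intro continuous_intros) auto

lemma C2_realI:
  assumes "\<And>x. (u has_real_derivative u' x) (at x)" "\<And>x. (u' has_real_derivative u'' x) (at x)"
    and "continuous_on UNIV u''"
  shows "C2_real u"
proof -
  have "deriv u = u'"
    using assms(1) DERIV_imp_deriv by blast
  moreover have "continuous_on UNIV u'"
    using assms(2) DERIV_continuous_on by blast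
  ultimately show ?thesis
    unfolding C2_real_def C1_differentiable_on_def
    using assms by (metis has_real_derivative_iff_has_vector_derivative)
qed

lemma h_fun_C2: "a > 0 \<Longrightarrow> C2_real (h_fun m a)"
  by (rule C2_realI[OF h_fun_deriv h_slope_deriv h_curv_continuous])

lemma f_fun_deriv: "a > 0 \<Longrightarrow> (f_fun m a K has_real_derivative h_slope m a g) (at g)"
  unfolding f_fun_def by (auto intro!: derivative_eq_intros h_fun_deriv)

lemma f_fun_C2: "a > 0 \<Longrightarrow> C2_real (f_fun m a K)"
  by (rule C2_realI[OF f_fun_deriv h_slope_deriv h_curv_continuous])

section \<open>Growth estimates for the candidate\<close>

lemma h_curv_bounds:
  assumes "a > 0" "m \<ge> 0"
  shows "0 \<le> h_curv m a g" "h_curv m a g \<le> 3 * m / (2 * a)"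
proof -
  have "3 * m / (2 * a) * max 0 (1 - (g / a)\<^sup>2) \<le> 3 * m / (2 * a) * 1"
    using assms by (intro mult_left_mono) auto
  then show "0 \<le> h_curv m a g" "h_curv m a g \<le> 3 * m / (2 * a)"
    using assms by (auto simp: h_curv_def)
qed

text \<open>Since \<open>h\<close> is convex, its slope increases from \<open>1/2 - m\<close> to \<open>1/2 + m\<close>, the values it takes far
  to the left and far to the right.\<close>
lemma h_slope_bounds:
  assumes "a > 0" "m \<ge> 0"
  shows "\<bar>h_slope m a g - 1 / 2\<bar> \<le> m"
proof -
  have mono: "h_slope m a x \<le> h_slope m a y" if "x \<le> y" for x y
    by (rule DERIV_nonneg_imp_nondecreasing[OF that])
       (use h_slope_deriv h_curv_bounds assms in blast)
  have "h_slope m a (max (\<bar>g\<bar> + 1) (a + 1)) = m + 1 / 2"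
    using assms by (auto simp: h_slope_def sgn_if)
  moreover have "h_slope m a (- max (\<bar>g\<bar> + 1) (a + 1)) = - m + 1 / 2"
    using assms by (auto simp: h_slope_def sgn_if)
  ultimately show ?thesis
    using mono[of g "max (\<bar>g\<bar> + 1) (a + 1)"] mono[of "- max (\<bar>g\<bar> + 1) (a + 1)" g]
    by (simp add: abs_if max_def split: if_splits)
qed

lemma f_fun_lipschitz:
  assumes "a > 0" "m \<ge> 0"
  shows "\<bar>f_fun m a K x - f_fun m a K y\<bar> \<le> (m + 1 / 2) * \<bar>x - y\<bar>"
proof -
  have "norm (f_fun m a K x - f_fun m a K y) \<le> (m + 1 / 2) * norm (x - y)"
  proof (rule field_differentiable_bound)
    show "(f_fun m a K has_real_derivative h_slope m a z) (at z within UNIV)" for z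
      using f_fun_deriv[OF assms(1)] by simp
    show "norm (h_slope m a z) \<le> m + 1 / 2" for z
      using h_slope_bounds[OF assms, of z] by simp
  qed auto
  then show ?thesis by simp
qed

text \<open>The second derivative is at most \<open>2 M\<close> for \<open>M = 3 m / (4 a)\<close>, so \<open>x \<mapsto> M x\<^sup>2 - f(x)\<close> is convex
  and lies above its tangent at \<open>g\<close>.\<close>
lemma f_fun_taylor:
  assumes "a > 0" "m \<ge> 0"
  shows "f_fun m a K (g + y) - f_fun m a K g - y * h_slope m a g \<le> 3 * m / (4 * a) * y\<^sup>2"
proof -
  define M where "M = 3 * m / (4 * a)"
  have M: "3 * m / (2 * a) = 2 * M"
    by (simp add: M_def)
  have "(2 * M * g - h_slope m a g) * (g + y - g) \<le>
      (M * (g + y)\<^sup>2 - f_fun m a K (g + y)) - (M * g\<^sup>2 - f_fun m a K g)"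
  proof (rule f''_imp_f'[where C = UNIV and f = "\<lambda>x. M * x\<^sup>2 - f_fun m a K x"
        and f' = "\<lambda>x. 2 * M * x - h_slope m a x" and f'' = "\<lambda>x. 2 * M - h_curv m a x"])
    show "((\<lambda>x. M * x\<^sup>2 - f_fun m a K x) has_real_derivative 2 * M * x - h_slope m a x) (at x)" for x
      by (auto intro!: derivative_eq_intros f_fun_deriv assms)
    show "((\<lambda>x. 2 * M * x - h_slope m a x) has_real_derivative 2 * M - h_curv m a x) (at x)" for x
      by (auto intro!: derivative_eq_intros h_slope_deriv assms)
    show "0 \<le> 2 * M - h_curv m a x" for x
      using h_curv_bounds(2)[OF assms, of x] M by simp
  qed auto
  then show ?thesis
    unfolding M_def[symmetric] by (simp add: algebra_simps power2_eq_square)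
qed

text \<open>Where \<open>f\<close> is affine the compensated increment vanishes. This is why small jumps cost nothing far
  from the origin, although their second moment may grow like \<open>g\<^sup>2\<close>.\<close>
lemma f_fun_affine_outside:
  assumes "a > 0" "\<bar>g\<bar> \<ge> a" "\<bar>g + y\<bar> \<ge> a" "sgn (g + y) = sgn g"
  shows "f_fun m a K (g + y) - f_fun m a K g - y * h_slope m a g = 0"
proof -
  have h: "h_fun m a x = m * \<bar>x\<bar> - 3 * a / 8 * m + x / 2" if "\<bar>x\<bar> \<ge> a" for x
  proof (cases "\<bar>x\<bar> = a")
    case True
    then have "x = a \<or> x = - a" by auto
    then show ?thesis using assms(1) by (auto simp: h_fun_def field_simps power_numeral_reduce)
  qed (use that in \<open>simp add: h_fun_def\<close>)
  have s: "h_slope m a g = m * sgn g + 1 / 2"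
  proof (cases "\<bar>g\<bar> = a")
    case True
    then have "g = a \<or> g = - a" by auto
    then show ?thesis using assms(1) by (auto simp: h_slope_def field_simps power_numeral_reduce)
  qed (use assms in \<open>simp add: h_slope_def\<close>)
  show ?thesis
    unfolding f_fun_def h[OF assms(2)] h[OF assms(3)] s using assms(1,4)
    by (auto simp: sgn_if abs_if algebra_simps split: if_splits)
qed

text \<open>With \<open>x = |g| / a \<le> 1\<close> the gap between the polynomial and the affine formula is
  \<open>m a / 8 (1 - x)\<^sup>3 (x + 3)\<close>, so the affine formula is a lower bound on the whole line.\<close>
lemma h_fun_lower:
  assumes "a > 0" "m \<ge> 0"
  shows "h_fun m a g \<ge> m * \<bar>g\<bar> - 3 * a / 8 * m + g / 2"
proof (cases "\<bar>g\<bar> \<le> a")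
  case True
  define x where "x = \<bar>g\<bar> / a"
  have x: "0 \<le> x" "x \<le> 1" and g: "\<bar>g\<bar> = a * x"
    using True assms by (auto simp: x_def)
  have "g\<^sup>2 = (a * x)\<^sup>2" "g ^ 4 = (a * x) ^ 4"
    using g by (metis power2_abs, metis g power_even_abs even_numeral)
  then have *: "3 * g\<^sup>2 / (4 * a) - g ^ 4 / (8 * a ^ 3) - \<bar>g\<bar> + 3 * a / 8
      = a / 8 * (6 * x\<^sup>2 - x ^ 4 - 8 * x + 3)"
    using assms g by (simp add: field_simps power_numeral_reduce)
  have "6 * x\<^sup>2 - x ^ 4 - 8 * x + 3 = (1 - x) ^ 3 * (x + 3)"
    by (simp add: algebra_simps power_numeral_reduce)
  also have "\<dots> \<ge> 0"
    using x by simp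
  finally have "3 * g\<^sup>2 / (4 * a) - g ^ 4 / (8 * a ^ 3) \<ge> \<bar>g\<bar> - 3 * a / 8"
    using * assms by (smt (verit) divide_nonneg_nonneg mult_nonneg_nonneg)
  then have "m * (3 * g\<^sup>2 / (4 * a) - g ^ 4 / (8 * a ^ 3)) \<ge> m * (\<bar>g\<bar> - 3 * a / 8)"
    using assms by (intro mult_left_mono)
  then show ?thesis
    using True by (simp add: h_fun_def algebra_simps)
qed (simp add: h_fun_def)

lemma f_fun_nonneg:
  assumes "a > 0" "m \<ge> 1 / 2" "K \<ge> 3 * a / 8 * m"
  shows "f_fun m a K g \<ge> 0"
proof -
  have "m * \<bar>g\<bar> \<ge> 1 / 2 * \<bar>g\<bar>"
    using assms by (intro mult_right_mono) auto
  then show ?thesis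
    using h_fun_lower[of a m g] assms unfolding f_fun_def by auto
qed

text \<open>Together with the preceding lower bound on \<open>h\<close> this gives the drift and discount terms the common
  leading part \<open>m |g| + g / 2\<close>, weighted by \<open>\<rho>\<close> and \<open>r\<close>: both help against the jumps.\<close>
lemma slope_lower:
  assumes "a > 0" "m \<ge> 0"
  shows "g * h_slope m a g \<ge> m * (\<bar>g\<bar> - a) + g / 2"
proof (cases "\<bar>g\<bar> \<le> a")
  case True
  define x where "x = g / a"
  have x: "x\<^sup>2 \<le> 1" and g: "g = a * x"
    using True assms by (auto simp: x_def abs_square_le_1)
  have "g * (3 * g / (2 * a) - g ^ 3 / (2 * a ^ 3)) = a / 2 * (x\<^sup>2 * (3 - x\<^sup>2))"
    using assms by (simp add: g field_simps power_numeral_reduce)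
  also have "\<dots> \<ge> 0"
    using x assms by (intro mult_nonneg_nonneg) auto
  finally have "m * (g * (3 * g / (2 * a) - g ^ 3 / (2 * a ^ 3))) \<ge> 0"
    using assms by simp
  moreover have "m * (\<bar>g\<bar> - a) \<le> 0"
    using assms True by (simp add: mult_nonneg_nonpos)
  ultimately show ?thesis
    using True by (simp add: h_slope_def algebra_simps)
next
  case False
  then show ?thesis
    using assms by (auto simp: h_slope_def sgn_if algebra_simps)
qed

section \<open>Test functions touching from below\<close>

lemma minimum_second_order:
  fixes d :: "real \<Rightarrow> real"
  assumes d: "\<And>x. (d has_real_derivative d' x) (at x)"
    and d2: "(d' has_real_derivative c) (at x\<^sub>0)"
    and min: "\<And>x. d x\<^sub>0 \<le> d x"
  shows "d' x\<^sub>0 = 0" "c \<ge> 0"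
proof -
  show z: "d' x\<^sub>0 = 0"
    by (rule DERIV_local_min[OF d, of 1]) (use min in auto)
  show "c \<ge> 0"
  proof (rule ccontr)
    assume "\<not> c \<ge> 0"
    then obtain e where e: "e > 0" "\<And>h. h > 0 \<Longrightarrow> h < e \<Longrightarrow> d' (x\<^sub>0 + h) < d' x\<^sub>0"
      using DERIV_neg_dec_right[OF d2] by auto
    have "d (x\<^sub>0 + e / 2) < d x\<^sub>0"
    proof (rule DERIV_neg_imp_decreasing_open[where f = d and a = x\<^sub>0])
      show "x\<^sub>0 < x\<^sub>0 + e / 2" using e by simp
      show "continuous_on {x\<^sub>0..x\<^sub>0 + e / 2} d"
        using d DERIV_atLeastAtMost_imp_continuous_on by blast
      show "\<exists>y. (d has_real_derivative y) (at x) \<and> y < 0" if "x\<^sub>0 < x" "x < x\<^sub>0 + e / 2" for x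
        using d[of x] e(2)[of "x - x\<^sub>0"] that z by auto
    qed
    then show False using min[of "x\<^sub>0 + e / 2"] by simp
  qed
qed

text \<open>Only times after \<open>t\<^sub>0\<close> are compared, so that the initial time \<open>t\<^sub>0 = a\<close> is covered; there the
  derivative may be strictly positive.\<close>
lemma minimum_right_derivative:
  fixes d :: "real \<Rightarrow> real"
  assumes d: "(d has_real_derivative c) (at t\<^sub>0 within {a..<T})"
    and t\<^sub>0: "t\<^sub>0 \<in> {a..<T}" and min: "\<And>t. t \<in> {a..<T} \<Longrightarrow> d t\<^sub>0 \<le> d t"
  shows "c \<ge> 0"
proof -
  have "(d has_real_derivative c) (at t\<^sub>0 within {t\<^sub>0<..<T})"
    by (rule DERIV_subset[OF d]) (use t\<^sub>0 in auto)
  then have lim: "((\<lambda>t. (d t - d t\<^sub>0) / (t - t\<^sub>0)) \<longlongrightarrow> c) (at t\<^sub>0 within {t\<^sub>0<..<T})"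
    by (simp add: has_field_derivative_iff)
  show ?thesis
  proof (rule tendsto_lowerbound[OF lim])
    show "\<forall>\<^sub>F t in at t\<^sub>0 within {t\<^sub>0<..<T}. 0 \<le> (d t - d t\<^sub>0) / (t - t\<^sub>0)"
      using min t\<^sub>0 by (auto simp: eventually_at_filter intro!: always_eventually divide_nonneg_pos)
    show "at t\<^sub>0 within {t\<^sub>0<..<T} \<noteq> bot"
      using t\<^sub>0 by (simp add: at_within_eq_bot_iff)
  qed
qed

text \<open>The candidate \<open>\<alpha>(t) F(g)\<close> is itself twice differentiable in \<open>g\<close> and
  differentiable in \<open>t\<close>, so a test function touching it from below satisfies the
  usual first and second order conditions. The time derivative then has a sign because \<open>\<alpha>' \<le> 0 \<le> F\<close>.\<close>
lemma touching_derivatives: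
  assumes prof: "time_profile T \<alpha>" and \<phi>: "C21 T \<phi>" and t\<^sub>0: "t\<^sub>0 \<in> {0..<T}"
    and F: "\<And>x. (F has_real_derivative F' x) (at x)"
    and F': "\<And>x. (F' has_real_derivative F'' x) (at x)"
    and Fpos: "F g\<^sub>0 \<ge> 0"
    and touch: "\<And>g t. t \<in> {0..<T} \<Longrightarrow> \<alpha> t\<^sub>0 * F g\<^sub>0 - \<phi> g\<^sub>0 t\<^sub>0 \<le> \<alpha> t * F g - \<phi> g t"
  shows "D_t T \<phi> g\<^sub>0 t\<^sub>0 \<le> 0" "D_g \<phi> g\<^sub>0 t\<^sub>0 = \<alpha> t\<^sub>0 * F' g\<^sub>0"
    "D_g (D_g \<phi>) g\<^sub>0 t\<^sub>0 \<le> \<alpha> t\<^sub>0 * F'' g\<^sub>0"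
proof -
  have dg: "((\<lambda>x. \<phi> x t\<^sub>0) has_real_derivative D_g \<phi> x t\<^sub>0) (at x)"
    and dgg: "((\<lambda>x. D_g \<phi> x t\<^sub>0) has_real_derivative D_g (D_g \<phi>) x t\<^sub>0) (at x)" for x
    using \<phi> t\<^sub>0 unfolding C21_def
    by (auto simp: DERIV_deriv_iff_real_differentiable D_g_def)
  have "((\<lambda>x. \<alpha> t\<^sub>0 * F x - \<phi> x t\<^sub>0) has_real_derivative (\<alpha> t\<^sub>0 * F' x - D_g \<phi> x t\<^sub>0)) (at x)"
    "((\<lambda>x. \<alpha> t\<^sub>0 * F' x - D_g \<phi> x t\<^sub>0) has_real_derivative (\<alpha> t\<^sub>0 * F'' x - D_g (D_g \<phi>) x t\<^sub>0)) (at x)"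
    for x
    by (auto intro!: derivative_eq_intros dg dgg F F')
  from minimum_second_order[OF this touch[OF t\<^sub>0]]
  show "D_g \<phi> g\<^sub>0 t\<^sub>0 = \<alpha> t\<^sub>0 * F' g\<^sub>0" "D_g (D_g \<phi>) g\<^sub>0 t\<^sub>0 \<le> \<alpha> t\<^sub>0 * F'' g\<^sub>0"
    by auto
  obtain a' where a': "\<And>t. t \<in> {0..T} \<Longrightarrow> (\<alpha> has_real_derivative a' t) (at t within {0..T}) \<and> a' t \<le> 0"
    using prof unfolding time_profile_def by blast
  then have "(\<alpha> has_real_derivative a' t\<^sub>0) (at t\<^sub>0 within {0..<T})"
    using t\<^sub>0 by (force intro: DERIV_subset)
  moreover have "(\<phi> g\<^sub>0 has_real_derivative D_t T \<phi> g\<^sub>0 t\<^sub>0) (at t\<^sub>0 within {0..<T})"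
    using \<phi> t\<^sub>0 unfolding C21_def D_t_def
    by (simp add: has_real_derivative_iff_has_vector_derivative flip: vector_derivative_works)
  ultimately have "((\<lambda>t. \<alpha> t * F g\<^sub>0 - \<phi> g\<^sub>0 t) has_real_derivative (a' t\<^sub>0 * F g\<^sub>0 - D_t T \<phi> g\<^sub>0 t\<^sub>0))
      (at t\<^sub>0 within {0..<T})"
    by (auto intro!: derivative_eq_intros)
  then have "a' t\<^sub>0 * F g\<^sub>0 - D_t T \<phi> g\<^sub>0 t\<^sub>0 \<ge> 0"
    using minimum_right_derivative t\<^sub>0 touch by blast
  moreover have "a' t\<^sub>0 * F g\<^sub>0 \<le> 0"
    using a'[of t\<^sub>0] t\<^sub>0 Fpos by (simp add: mult_nonpos_nonneg)
  ultimately show "D_t T \<phi> g\<^sub>0 t\<^sub>0 \<le> 0" by simp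
qed

section \<open>The split operator on a separable function\<close>

lemma levy_sets:
  assumes "levy_measure \<nu>" "S \<in> sets borel" "0 \<notin> S"
  shows "S \<in> sets \<nu>"
proof -
  have "S = - {0} \<inter> S" using assms by auto
  then show ?thesis
    using assms unfolding levy_measure_def by (auto simp: sets_restrict_space)
qed

lemma admissible_measurable:
  assumes "levy_measure \<nu>" "admissible_jump \<nu> L \<gamma>"
  shows "\<gamma> g \<in> borel_measurable \<nu>"
  using assms measurable_cong_sets[of \<nu> "restrict_space borel (- {0})" borel borel]
  unfolding levy_measure_def admissible_jump_def by auto

text \<open>Below the touched function the test function only has smaller increments, so in both parts of the
  split operator the integrand is at most \<open>\<alpha>(t\<^sub>0)\<close> times the compensated increment of \<open>F\<close>. The bound
  \<open>B\<close> on these increments is integrable and nonnegative, and such a bound also dominates an integral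
  that is 0 by the convention for non-integrable functions. Since \<open>B\<close> does not depend on the threshold
  \<open>\<delta>\<close>, the two parts recombine into one integral.\<close>
lemma split_op_touching_le:
  assumes \<nu>: "levy_measure \<nu>"
    and prof: "time_profile T \<alpha>" and \<phi>: "C21 T \<phi>" and t\<^sub>0: "t\<^sub>0 \<in> {0..<T}" and \<delta>: "0 < \<delta>" "\<delta> < 1"
    and F: "\<And>x. (F has_real_derivative F' x) (at x)"
    and F': "\<And>x. (F' has_real_derivative F'' x) (at x)"
    and Fpos: "F g\<^sub>0 \<ge> 0"
    and touch: "\<And>g t. t \<in> {0..<T} \<Longrightarrow> \<alpha> t\<^sub>0 * F g\<^sub>0 - \<phi> g\<^sub>0 t\<^sub>0 \<le> \<alpha> t * F g - \<phi> g t"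
    and B: "integrable \<nu> B" "\<And>z. 0 \<le> B z"
    and small: "\<And>z. 0 < \<bar>z\<bar> \<Longrightarrow> \<bar>z\<bar> \<le> 1 \<Longrightarrow> F (g\<^sub>0 + \<gamma> g\<^sub>0 z) - F g\<^sub>0 - \<gamma> g\<^sub>0 z * F' g\<^sub>0 \<le> B z"
    and large: "\<And>z. 1 < \<bar>z\<bar> \<Longrightarrow> F (g\<^sub>0 + \<gamma> g\<^sub>0 z) - F g\<^sub>0 \<le> B z"
  shows "split_op T r \<rho> \<sigma> \<nu> \<gamma> \<delta> \<phi> (\<lambda>g t. \<alpha> t * F g) g\<^sub>0 t\<^sub>0
    \<le> \<alpha> t\<^sub>0 * (\<sigma>\<^sup>2 / 2 * F'' g\<^sub>0 - \<rho> * g\<^sub>0 * F' g\<^sub>0 - r * F g\<^sub>0 + (\<integral>z. B z \<partial>\<nu>))"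
proof -
  have D: "D_t T \<phi> g\<^sub>0 t\<^sub>0 \<le> 0" "D_g \<phi> g\<^sub>0 t\<^sub>0 = \<alpha> t\<^sub>0 * F' g\<^sub>0"
      "D_g (D_g \<phi>) g\<^sub>0 t\<^sub>0 \<le> \<alpha> t\<^sub>0 * F'' g\<^sub>0"
    using touching_derivatives[of T \<alpha> \<phi> t\<^sub>0 F F' F'' g\<^sub>0, OF prof \<phi> t\<^sub>0 F F' Fpos touch] by simp_all
  have \<alpha>: "\<alpha> t\<^sub>0 \<ge> 0"
    using prof t\<^sub>0 unfolding time_profile_def by auto
  let ?S = "{z::real. 0 < \<bar>z\<bar> \<and> \<bar>z\<bar> \<le> \<delta>}" and ?U = "{z::real. \<bar>z\<bar> > \<delta>}"
  have S [measurable]: "?S \<in> sets \<nu>" and U [measurable]: "?U \<in> sets \<nu>"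
    using \<delta> by (auto intro!: levy_sets[OF \<nu>])
  have int: "integrable \<nu> (\<lambda>z. indicator ?S z * (\<alpha> t\<^sub>0 * B z))"
      "integrable \<nu> (\<lambda>z. indicator ?U z * (\<alpha> t\<^sub>0 * B z))"
    using integrable_mult_indicator[OF S, of "\<lambda>z. \<alpha> t\<^sub>0 * B z"]
      integrable_mult_indicator[OF U, of "\<lambda>z. \<alpha> t\<^sub>0 * B z"] B(1)
    unfolding real_scaleR_def by (auto simp del: zero_less_abs_iff)
  have "I1 \<nu> \<gamma> \<delta> \<phi> g\<^sub>0 t\<^sub>0 \<le> (\<integral>z. indicator ?S z * (\<alpha> t\<^sub>0 * B z) \<partial>\<nu>)"
    unfolding I1_def set_lebesgue_integral_def
  proof (rule integral_mono'[OF int(1)])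
    fix z assume "z \<in> space \<nu>"
    show "0 \<le> indicator ?S z * (\<alpha> t\<^sub>0 * B z)"
      using \<alpha> B(2) by simp
    show "indicator ?S z *\<^sub>R (\<phi> (g\<^sub>0 + \<gamma> g\<^sub>0 z) t\<^sub>0 - \<phi> g\<^sub>0 t\<^sub>0 - \<gamma> g\<^sub>0 z * D_g \<phi> g\<^sub>0 t\<^sub>0)
        \<le> indicator ?S z * (\<alpha> t\<^sub>0 * B z)"
    proof (cases "z \<in> ?S")
      case True
      then have "\<alpha> t\<^sub>0 * (F (g\<^sub>0 + \<gamma> g\<^sub>0 z) - F g\<^sub>0 - \<gamma> g\<^sub>0 z * F' g\<^sub>0) \<le> \<alpha> t\<^sub>0 * B z"
        using small[of z] \<delta> \<alpha> by (intro mult_left_mono) auto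
      then show ?thesis
        using True touch[OF t\<^sub>0, of "g\<^sub>0 + \<gamma> g\<^sub>0 z"] unfolding D(2) by (simp add: algebra_simps)
    qed simp
  qed
  moreover have "I2 \<nu> \<gamma> \<delta> (\<lambda>g t. \<alpha> t * F g) \<phi> g\<^sub>0 t\<^sub>0 \<le> (\<integral>z. indicator ?U z * (\<alpha> t\<^sub>0 * B z) \<partial>\<nu>)"
    unfolding I2_def set_lebesgue_integral_def
  proof (rule integral_mono'[OF int(2)])
    fix z assume "z \<in> space \<nu>"
    show "0 \<le> indicator ?U z * (\<alpha> t\<^sub>0 * B z)"
      using \<alpha> B(2) by simp
    show "indicator ?U z *\<^sub>R (\<alpha> t\<^sub>0 * F (g\<^sub>0 + \<gamma> g\<^sub>0 z) - \<alpha> t\<^sub>0 * F g\<^sub>0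
          - \<gamma> g\<^sub>0 z * D_g \<phi> g\<^sub>0 t\<^sub>0 * indicator {z. \<bar>z\<bar> \<le> 1} z)
        \<le> indicator ?U z * (\<alpha> t\<^sub>0 * B z)"
    proof (cases "\<bar>z\<bar> \<le> 1")
      case True
      have "\<alpha> t\<^sub>0 * (F (g\<^sub>0 + \<gamma> g\<^sub>0 z) - F g\<^sub>0 - \<gamma> g\<^sub>0 z * F' g\<^sub>0) \<le> \<alpha> t\<^sub>0 * B z" if "z \<in> ?U"
        using small[of z] True \<delta> \<alpha> that by (intro mult_left_mono) auto
      then show ?thesis
        using True unfolding D(2) by (simp add: algebra_simps indicator_def)
    next
      case False
      then have "\<alpha> t\<^sub>0 * (F (g\<^sub>0 + \<gamma> g\<^sub>0 z) - F g\<^sub>0) \<le> \<alpha> t\<^sub>0 * B z"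
        using large[of z] \<alpha> by (intro mult_left_mono) auto
      then show ?thesis
        using False by (simp add: algebra_simps indicator_def)
    qed
  qed
  moreover have "(\<integral>z. indicator ?S z * (\<alpha> t\<^sub>0 * B z) \<partial>\<nu>) + (\<integral>z. indicator ?U z * (\<alpha> t\<^sub>0 * B z) \<partial>\<nu>)
      \<le> \<alpha> t\<^sub>0 * (\<integral>z. B z \<partial>\<nu>)"
  proof -
    have "(\<integral>z. indicator ?S z * (\<alpha> t\<^sub>0 * B z) + indicator ?U z * (\<alpha> t\<^sub>0 * B z) \<partial>\<nu>)
        \<le> (\<integral>z. \<alpha> t\<^sub>0 * B z \<partial>\<nu>)"
      using B \<alpha> by (intro integral_mono') (auto simp: indicator_def)
    then show ?thesis
      using int by simp
  qed
  moreover have "\<sigma>\<^sup>2 / 2 * D_g (D_g \<phi>) g\<^sub>0 t\<^sub>0 \<le> \<sigma>\<^sup>2 / 2 * (\<alpha> t\<^sub>0 * F'' g\<^sub>0)"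
    using D(3) by (intro mult_left_mono) auto
  ultimately show ?thesis
    using D(1) unfolding split_op_def D(2) by (simp add: algebra_simps)
qed

section \<open>Integrals of the jump amplitude\<close>

text \<open>The factor 2 from \<open>(x + y)\<^sup>2 \<le> 2 x\<^sup>2 + 2 y\<^sup>2\<close> is harmless: the growth bound is only used for bounded
  \<open>g\<close>.\<close>
lemma admissible_square_integral:
  assumes \<nu>: "levy_measure \<nu>" and \<gamma>: "admissible_jump \<nu> L \<gamma>"
  shows "integrable \<nu> (\<lambda>z. (\<gamma> g z)\<^sup>2)"
    "(\<integral>z. (\<gamma> g z)\<^sup>2 \<partial>\<nu>) \<le> 2 * L\<^sup>2 * g\<^sup>2 + 2 * (\<integral>z. (\<gamma> 0 z)\<^sup>2 \<partial>\<nu>)"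
proof -
  note [measurable] = admissible_measurable[OF \<nu> \<gamma>]
  have nn: "(\<integral>\<^sup>+z. ennreal ((\<gamma> g z - \<gamma> 0 z)\<^sup>2) \<partial>\<nu>) \<le> ennreal (L\<^sup>2 * g\<^sup>2)"
  proof -
    have "(\<integral>\<^sup>+z. ennreal (\<bar>\<gamma> g z - \<gamma> 0 z\<bar>\<^sup>2) \<partial>\<nu>) \<le> ennreal (L\<^sup>2 * \<bar>g - 0\<bar>\<^sup>2)"
      using \<gamma> unfolding admissible_jump_def by blast
    then show ?thesis by simp
  qed
  have i0: "integrable \<nu> (\<lambda>z. (\<gamma> 0 z)\<^sup>2)"
    using \<gamma> unfolding admissible_jump_def by (intro integrableI_nonneg) auto
  have id: "integrable \<nu> (\<lambda>z. (\<gamma> g z - \<gamma> 0 z)\<^sup>2)"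
    using nn by (intro integrableI_nonneg) (auto simp: less_top[symmetric] top_unique)
  have dle: "(\<integral>z. (\<gamma> g z - \<gamma> 0 z)\<^sup>2 \<partial>\<nu>) \<le> L\<^sup>2 * g\<^sup>2"
    using nn nn_integral_eq_integral[OF id] by (simp add: ennreal_le_iff)
  have le: "(\<gamma> g z)\<^sup>2 \<le> 2 * (\<gamma> g z - \<gamma> 0 z)\<^sup>2 + 2 * (\<gamma> 0 z)\<^sup>2" for z
    using zero_le_power2[of "\<gamma> g z - 2 * \<gamma> 0 z"] by (simp add: power2_eq_square algebra_simps)
  have isum: "integrable \<nu> (\<lambda>z. 2 * (\<gamma> g z - \<gamma> 0 z)\<^sup>2 + 2 * (\<gamma> 0 z)\<^sup>2)"
    using i0 id by simp
  show ig: "integrable \<nu> (\<lambda>z. (\<gamma> g z)\<^sup>2)"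
    by (rule Bochner_Integration.integrable_bound[OF isum]) (use le in auto)
  have "(\<integral>z. (\<gamma> g z)\<^sup>2 \<partial>\<nu>) \<le> (\<integral>z. 2 * (\<gamma> g z - \<gamma> 0 z)\<^sup>2 + 2 * (\<gamma> 0 z)\<^sup>2 \<partial>\<nu>)"
    using ig isum le by (intro integral_mono) auto
  then show "(\<integral>z. (\<gamma> g z)\<^sup>2 \<partial>\<nu>) \<le> 2 * L\<^sup>2 * g\<^sup>2 + 2 * (\<integral>z. (\<gamma> 0 z)\<^sup>2 \<partial>\<nu>)"
    using i0 id dle by simp
qed

text \<open>The growth rate has to be exactly \<open>sqrt \<lambda> * L\<close>, with no constant in front, as this is the quantity
  compared with \<open>r + \<rho>\<close>. Hence \<open>\<gamma> g\<close> is split into \<open>\<gamma> g - \<gamma> 0\<close>, to which Cauchy--Schwarz on \<open>|z| > 1\<close>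
  and the Lipschitz condition apply, and \<open>\<gamma> 0\<close>, which contributes a constant.\<close>
lemma large_jump_integral:
  assumes \<nu>: "levy_measure \<nu>" and \<gamma>: "admissible_jump \<nu> L \<gamma>" and L: "L \<ge> 0"
    and fin: "emeasure \<nu> {z. \<bar>z\<bar> > 1} < \<infinity>"
  shows "integrable \<nu> (\<lambda>z. \<bar>\<gamma> g z\<bar> * indicator {z. \<bar>z\<bar> > 1} z)"
    "(\<integral>z. \<bar>\<gamma> g z\<bar> * indicator {z. \<bar>z\<bar> > 1} z \<partial>\<nu>) \<le>
       sqrt (measure \<nu> {z. \<bar>z\<bar> > 1}) * L * \<bar>g\<bar> + (\<integral>z. \<bar>\<gamma> 0 z\<bar> * indicator {z. \<bar>z\<bar> > 1} z \<partial>\<nu>)"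
proof -
  note [measurable] = admissible_measurable[OF \<nu> \<gamma>]
  let ?A = "{z::real. \<bar>z\<bar> > 1}"
  have [measurable]: "?A \<in> sets \<nu>"
    by (auto intro!: levy_sets[OF \<nu>])
  have iA: "integrable \<nu> (indicator ?A :: real \<Rightarrow> real)"
    using fin by simp
  have int: "integrable \<nu> (\<lambda>z. \<bar>\<gamma> x z\<bar> * indicator ?A z)" for x
  proof (rule Bochner_Integration.integrable_bound)
    show "integrable \<nu> (\<lambda>z. (\<gamma> x z)\<^sup>2 + indicator ?A z)"
      using admissible_square_integral(1)[OF \<nu> \<gamma>] iA by simp
    have "\<bar>y\<bar> \<le> y\<^sup>2 + 1" for y :: real
      using zero_le_power2[of "\<bar>y\<bar> - 1"] by (simp add: power2_eq_square algebra_simps)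
    then show "AE z in \<nu>. norm (\<bar>\<gamma> x z\<bar> * indicator ?A z) \<le> norm ((\<gamma> x z)\<^sup>2 + indicator ?A z)"
      by (auto simp: indicator_def)
  qed measurable
  then show "integrable \<nu> (\<lambda>z. \<bar>\<gamma> g z\<bar> * indicator ?A z)" .
  have id: "integrable \<nu> (\<lambda>z. \<bar>\<gamma> g z - \<gamma> 0 z\<bar> * indicator ?A z)"
  proof (rule Bochner_Integration.integrable_bound)
    show "integrable \<nu> (\<lambda>z. \<bar>\<gamma> g z\<bar> * indicator ?A z + \<bar>\<gamma> 0 z\<bar> * indicator ?A z)"
      using int by simp
    show "(\<lambda>z. \<bar>\<gamma> g z - \<gamma> 0 z\<bar> * indicator ?A z) \<in> borel_measurable \<nu>"
      by measurable
  qed (auto simp: indicator_def)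
  let ?I = "\<integral>z. \<bar>\<gamma> g z - \<gamma> 0 z\<bar> * indicator ?A z \<partial>\<nu>"
  have "ennreal (?I\<^sup>2) = (\<integral>\<^sup>+z. ennreal \<bar>\<gamma> g z - \<gamma> 0 z\<bar> * indicator ?A z \<partial>\<nu>)\<^sup>2"
  proof -
    have "ennreal ?I = (\<integral>\<^sup>+z. ennreal (\<bar>\<gamma> g z - \<gamma> 0 z\<bar> * indicator ?A z) \<partial>\<nu>)"
      by (rule nn_integral_eq_integral[symmetric, OF id]) simp
    also have "\<dots> = (\<integral>\<^sup>+z. ennreal \<bar>\<gamma> g z - \<gamma> 0 z\<bar> * indicator ?A z \<partial>\<nu>)"
      by (intro nn_integral_cong) (simp add: indicator_def)
    finally show ?thesis
      by (simp add: ennreal_power[symmetric])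
  qed
  also have "\<dots> \<le> (\<integral>\<^sup>+z. (ennreal \<bar>\<gamma> g z - \<gamma> 0 z\<bar>)\<^sup>2 \<partial>\<nu>) * (\<integral>\<^sup>+z. (indicator ?A z)\<^sup>2 \<partial>\<nu>)"
    by (rule Cauchy_Schwarz_nn_integral) measurable
  also have "(\<integral>\<^sup>+z. (indicator ?A z)\<^sup>2 \<partial>\<nu>) = (\<integral>\<^sup>+z. indicator ?A z \<partial>\<nu>)"
    by (intro nn_integral_cong) (simp add: indicator_def)
  also have "\<dots> = ennreal (measure \<nu> ?A)"
    using fin by (simp add: emeasure_eq_ennreal_measure less_top[symmetric])
  also have "(\<integral>\<^sup>+z. (ennreal \<bar>\<gamma> g z - \<gamma> 0 z\<bar>)\<^sup>2 \<partial>\<nu>) \<le> ennreal (L\<^sup>2 * \<bar>g - 0\<bar>\<^sup>2)"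
    using \<gamma> unfolding admissible_jump_def by (simp only: ennreal_power abs_ge_zero)
  finally have "ennreal (?I\<^sup>2) \<le> ennreal (L\<^sup>2 * \<bar>g - 0\<bar>\<^sup>2) * ennreal (measure \<nu> ?A)"
    by (simp add: mult_right_mono)
  then have "?I\<^sup>2 \<le> L\<^sup>2 * \<bar>g - 0\<bar>\<^sup>2 * measure \<nu> ?A"
    by (simp add: ennreal_mult'[symmetric] ennreal_le_iff)
  also have "\<dots> = (sqrt (measure \<nu> ?A) * L * \<bar>g\<bar>)\<^sup>2"
    by (simp add: power_mult_distrib)
  finally have I: "?I \<le> sqrt (measure \<nu> ?A) * L * \<bar>g\<bar>"
    by (rule power2_le_imp_le) (simp add: L)
  have "(\<integral>z. \<bar>\<gamma> g z\<bar> * indicator ?A z \<partial>\<nu>)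
      \<le> (\<integral>z. \<bar>\<gamma> g z - \<gamma> 0 z\<bar> * indicator ?A z + \<bar>\<gamma> 0 z\<bar> * indicator ?A z \<partial>\<nu>)"
    using int id by (intro integral_mono) (auto simp: indicator_def)
  also have "\<dots> = ?I + (\<integral>z. \<bar>\<gamma> 0 z\<bar> * indicator ?A z \<partial>\<nu>)"
    using int id by simp
  finally show "(\<integral>z. \<bar>\<gamma> g z\<bar> * indicator ?A z \<partial>\<nu>) \<le>
      sqrt (measure \<nu> ?A) * L * \<bar>g\<bar> + (\<integral>z. \<bar>\<gamma> 0 z\<bar> * indicator ?A z \<partial>\<nu>)"
    using I by simp
qed

text \<open>For large \<open>|g|\<close> a small jump has size at most \<open>(1 - \<epsilon> / 2) |g|\<close>, hence lands on the same side of the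
  origin at distance at least \<open>\<epsilon> |g| / 2 \<ge> a\<close>, still in the region where the candidate is affine.\<close>
lemma small_jumps_subcritical:
  assumes \<gamma>: "admissible_jump \<nu> L \<gamma>" and a: "a > 0"
  obtains R where "R \<ge> a"
    "\<And>g z. \<bar>g\<bar> \<ge> R \<Longrightarrow> 0 < \<bar>z\<bar> \<Longrightarrow> \<bar>z\<bar> \<le> 1 \<Longrightarrow> \<bar>g + \<gamma> g z\<bar> \<ge> a \<and> sgn (g + \<gamma> g z) = sgn g"
proof -
  obtain \<epsilon> where \<epsilon>: "0 < \<epsilon>" "\<epsilon> < 1" and
    ls: "Limsup at_infinity (\<lambda>g. SUP z\<in>{z. 0 < \<bar>z\<bar> \<and> \<bar>z\<bar> \<le> 1}. ereal (\<bar>\<gamma> g z\<bar> / \<bar>g\<bar>)) \<le> ereal (1 - \<epsilon>)"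
    using \<gamma> unfolding admissible_jump_def by blast
  have "eventually (\<lambda>g. (SUP z\<in>{z. 0 < \<bar>z\<bar> \<and> \<bar>z\<bar> \<le> 1}. ereal (\<bar>\<gamma> g z\<bar> / \<bar>g\<bar>)) < ereal (1 - \<epsilon> / 2))
      at_infinity"
    using \<epsilon> by (intro Limsup_lessD le_less_trans[OF ls]) simp
  then obtain R\<^sub>0 where R\<^sub>0: "\<And>g. \<bar>g\<bar> \<ge> R\<^sub>0 \<Longrightarrow>
      (SUP z\<in>{z. 0 < \<bar>z\<bar> \<and> \<bar>z\<bar> \<le> 1}. ereal (\<bar>\<gamma> g z\<bar> / \<bar>g\<bar>)) < ereal (1 - \<epsilon> / 2)"
    unfolding eventually_at_infinity by auto
  have "\<bar>g + \<gamma> g z\<bar> \<ge> a \<and> sgn (g + \<gamma> g z) = sgn g"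
    if "\<bar>g\<bar> \<ge> max R\<^sub>0 (2 * a / \<epsilon>)" "0 < \<bar>z\<bar>" "\<bar>z\<bar> \<le> 1" for g z
  proof -
    have "0 < 2 * a / \<epsilon>" using a \<epsilon> by simp
    then have g: "\<bar>g\<bar> > 0" "\<epsilon> * \<bar>g\<bar> \<ge> 2 * a"
      using that(1) \<epsilon> by (auto simp: field_simps)
    have "ereal (\<bar>\<gamma> g z\<bar> / \<bar>g\<bar>) \<le> (SUP z\<in>{z. 0 < \<bar>z\<bar> \<and> \<bar>z\<bar> \<le> 1}. ereal (\<bar>\<gamma> g z\<bar> / \<bar>g\<bar>))"
      using that by (intro SUP_upper) auto
    also have "\<dots> < ereal (1 - \<epsilon> / 2)"
      using that(1) by (intro R\<^sub>0) simp
    finally have "\<bar>\<gamma> g z\<bar> / \<bar>g\<bar> < 1 - \<epsilon> / 2"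
      by simp
    then have "\<bar>\<gamma> g z\<bar> < (1 - \<epsilon> / 2) * \<bar>g\<bar>"
      using g(1) by (simp add: pos_divide_less_eq)
    then have "\<bar>\<gamma> g z\<bar> \<le> \<bar>g\<bar> - a"
      using g(2) by (simp add: algebra_simps)
    then show ?thesis
      using a by (auto simp: sgn_if)
  qed
  moreover have "a \<le> 2 * a / \<epsilon>"
    using a \<epsilon> by (simp add: field_simps)
  ultimately show ?thesis
    using that[of "max R\<^sub>0 (2 * a / \<epsilon>)"] by auto
qed

text \<open>A dominating function as required by the comparison of the split operator: small jumps are
  controlled by the second derivative while \<open>|g| < R\<close> and contribute nothing for \<open>|g| \<ge> R\<close>; large
  jumps are controlled by the Lipschitz constant \<open>m + 1/2\<close>. Neither \<open>B\<close> nor \<open>C\<close> involves \<open>K\<close>, so that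
  \<open>K\<close> may be chosen afterwards.\<close>
lemma jump_part_domination:
  assumes \<nu>: "levy_measure \<nu>" and \<gamma>: "admissible_jump \<nu> L \<gamma>" and L: "L \<ge> 0"
    and fin: "emeasure \<nu> {z. \<bar>z\<bar> > 1} < \<infinity>" and a: "a > 0" and m: "m \<ge> 0"
  obtains C B where
    "\<And>g. integrable \<nu> (B g)" "\<And>g z. 0 \<le> B g z"
    "\<And>K g z. 0 < \<bar>z\<bar> \<Longrightarrow> \<bar>z\<bar> \<le> 1 \<Longrightarrow>
       f_fun m a K (g + \<gamma> g z) - f_fun m a K g - \<gamma> g z * h_slope m a g \<le> B g z"
    "\<And>K g z. 1 < \<bar>z\<bar> \<Longrightarrow> f_fun m a K (g + \<gamma> g z) - f_fun m a K g \<le> B g z"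
    "\<And>g. (\<integral>z. B g z \<partial>\<nu>) \<le> (m + 1 / 2) * (sqrt (measure \<nu> {z. \<bar>z\<bar> > 1}) * L) * \<bar>g\<bar> + C"
proof -
  obtain R where R: "R \<ge> a"
    "\<And>g z. \<bar>g\<bar> \<ge> R \<Longrightarrow> 0 < \<bar>z\<bar> \<Longrightarrow> \<bar>z\<bar> \<le> 1 \<Longrightarrow> \<bar>g + \<gamma> g z\<bar> \<ge> a \<and> sgn (g + \<gamma> g z) = sgn g"
    by (rule small_jumps_subcritical[OF \<gamma> a]) blast
  let ?A = "{z::real. \<bar>z\<bar> > 1}"
  define M where "M = 3 * m / (4 * a)"
  have M: "M \<ge> 0" using a m by (simp add: M_def)
  define k where "k g = (if \<bar>g\<bar> < R then M else 0)" for g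
  have k: "k g \<ge> 0" for g using M by (simp add: k_def)
  define B where "B g z = k g * (\<gamma> g z)\<^sup>2 + (m + 1 / 2) * (\<bar>\<gamma> g z\<bar> * indicator ?A z)" for g z
  define G where "G = (\<integral>z. (\<gamma> 0 z)\<^sup>2 \<partial>\<nu>)"
  define C\<^sub>0 where "C\<^sub>0 = (\<integral>z. \<bar>\<gamma> 0 z\<bar> * indicator ?A z \<partial>\<nu>)"
  note sq = admissible_square_integral[OF \<nu> \<gamma>, folded G_def]
  note big = large_jump_integral[OF \<nu> \<gamma> L fin, folded C\<^sub>0_def]
  have G: "G \<ge> 0" by (simp add: G_def)
  show ?thesis
  proof (rule that)
    show "integrable \<nu> (B g)" for g
      unfolding B_def using sq(1) big(1) by simp
    show "0 \<le> B g z" for g z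
      unfolding B_def using k m by simp
    show "f_fun m a K (g + \<gamma> g z) - f_fun m a K g - \<gamma> g z * h_slope m a g \<le> B g z"
      if z: "0 < \<bar>z\<bar>" "\<bar>z\<bar> \<le> 1" for K g z
    proof (cases "\<bar>g\<bar> < R")
      case True
      then show ?thesis
        using f_fun_taylor[OF a m, of K g "\<gamma> g z"] z by (simp add: B_def k_def M_def)
    next
      case False
      then have "f_fun m a K (g + \<gamma> g z) - f_fun m a K g - \<gamma> g z * h_slope m a g = 0"
        using R(1) R(2)[of g z] z a by (intro f_fun_affine_outside) auto
      then show ?thesis
        using \<open>0 \<le> B g z\<close> by simp
    qed
    show "f_fun m a K (g + \<gamma> g z) - f_fun m a K g \<le> B g z" if z: "1 < \<bar>z\<bar>" for K g z
    proof -
      have "f_fun m a K (g + \<gamma> g z) - f_fun m a K g \<le> (m + 1 / 2) * \<bar>\<gamma> g z\<bar>"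
        using f_fun_lipschitz[OF a m, of K "g + \<gamma> g z" g] by simp
      then show ?thesis
        using z k[of g] by (simp add: B_def add_increasing)
    qed
    show "(\<integral>z. B g z \<partial>\<nu>) \<le> (m + 1 / 2) * (sqrt (measure \<nu> ?A) * L) * \<bar>g\<bar>
        + (M * (2 * L\<^sup>2 * R\<^sup>2 + 2 * G) + (m + 1 / 2) * C\<^sub>0)" for g
    proof -
      have "(\<integral>z. B g z \<partial>\<nu>) = k g * (\<integral>z. (\<gamma> g z)\<^sup>2 \<partial>\<nu>)
          + (m + 1 / 2) * (\<integral>z. \<bar>\<gamma> g z\<bar> * indicator ?A z \<partial>\<nu>)"
        unfolding B_def using sq(1) big(1) by simp
      moreover have "k g * (\<integral>z. (\<gamma> g z)\<^sup>2 \<partial>\<nu>) \<le> M * (2 * L\<^sup>2 * R\<^sup>2 + 2 * G)"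
      proof (cases "\<bar>g\<bar> < R")
        case True
        then have "g\<^sup>2 \<le> R\<^sup>2"
          by (simp add: abs_le_square_iff[symmetric])
        then have "2 * L\<^sup>2 * g\<^sup>2 \<le> 2 * L\<^sup>2 * R\<^sup>2"
          by (intro mult_left_mono) auto
        then have "(\<integral>z. (\<gamma> g z)\<^sup>2 \<partial>\<nu>) \<le> 2 * L\<^sup>2 * R\<^sup>2 + 2 * G"
          using sq(2)[of g] by linarith
        then show ?thesis
          using True M by (simp add: k_def mult_left_mono)
      next
        case False
        then show ?thesis using M G by (simp add: k_def)
      qed
      moreover have "(m + 1 / 2) * (\<integral>z. \<bar>\<gamma> g z\<bar> * indicator ?A z \<partial>\<nu>)
          \<le> (m + 1 / 2) * (sqrt (measure \<nu> ?A) * L * \<bar>g\<bar> + C\<^sub>0)"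
        using big(2)[of g] m by (intro mult_left_mono) auto
      ultimately show ?thesis
        by (simp add: algebra_simps)
    qed
  qed
qed

section \<open>The supersolution property\<close>

lemma time_profile_facts:
  assumes "time_profile T \<alpha>"
  shows "continuous_on {0..T} \<alpha>" "\<And>t. t \<in> {0..T} \<Longrightarrow> \<alpha> t \<ge> 0" "\<alpha> T = 0"
  using assms unfolding time_profile_def by (auto intro: DERIV_continuous_on)

lemma separable_lsc:
  assumes "continuous_on {0..T} \<alpha>" "continuous_on UNIV F"
  shows "lsc_on (UNIV \<times> {0..T}) (\<lambda>(g, t). \<alpha> t * F g)"
proof -
  have "continuous_on (UNIV \<times> {0..T}) (\<lambda>p. \<alpha> (snd p) * F (fst p))"
    by (intro continuous_on_mult continuous_on_compose2[OF assms(1)]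
        continuous_on_compose2[OF assms(2)] continuous_intros) auto
  then show ?thesis
    unfolding lsc_on_def continuous_on_def
    by (auto simp: case_prod_unfold dest!: bspec dest: order_tendstoD(1))
qed

lemma separable_linear_growth:
  assumes "continuous_on {0..T} \<alpha>" "\<And>x. \<bar>F x\<bar> \<le> k * (\<bar>x\<bar> + 1)" "k \<ge> 0"
  shows "linear_growth T (\<lambda>g t. \<alpha> t * F g)"
proof -
  have "bounded (\<alpha> ` {0..T})"
    using assms(1) by (intro compact_imp_bounded compact_continuous_image) auto
  then obtain A where A: "A > 0" "\<And>t. t \<in> {0..T} \<Longrightarrow> \<bar>\<alpha> t\<bar> \<le> A"
    by (auto simp: bounded_pos)
  show ?thesis
    unfolding linear_growth_def
  proof (intro exI conjI allI ballI)
    show "0 < A * k + 1" using A assms(3) by (simp add: add_nonneg_pos)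
    fix g t assume "t \<in> {0..T}"
    then have "\<bar>\<alpha> t\<bar> * \<bar>F g\<bar> \<le> A * (k * (\<bar>g\<bar> + 1))"
      using A assms by (intro mult_mono) auto
    also have "\<dots> \<le> (A * k + 1) * (\<bar>g\<bar> + 1)"
      by (simp add: algebra_simps)
    finally show "\<bar>\<alpha> t * F g\<bar> \<le> (A * k + 1) * (\<bar>g\<bar> + 1)"
      by (simp add: abs_mult)
  qed
qed

text \<open>Every term growing in \<open>g\<close> is absorbed by \<open>(r + \<rho>) (m |g| + g / 2) \<ge> (r + \<rho>) (m - 1/2) |g|\<close>, where
  \<open>m - 1/2\<close> is the rate on the unfavourable side \<open>g < 0\<close>. What remains is constant and is paid for by
  \<open>r K\<close>.\<close>
lemma stationary_inequality:
  assumes a: "a > 0" and m: "m \<ge> 0" and r: "r \<ge> 0" and \<rho>: "\<rho> \<ge> 0"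
    and dom: "(m + 1 / 2) * s \<le> (r + \<rho>) * (m - 1 / 2)"
    and J: "J \<le> (m + 1 / 2) * s * \<bar>g\<bar> + C"
    and K: "r * K \<ge> r * (3 * a / 8 * m) + \<rho> * (m * a) + \<sigma>\<^sup>2 / 2 * (3 * m / (2 * a)) + C"
  shows "\<sigma>\<^sup>2 / 2 * h_curv m a g - \<rho> * g * h_slope m a g - r * f_fun m a K g + J \<le> 0"
proof -
  define Q where "Q = \<sigma>\<^sup>2 / 2 * (3 * m / (2 * a))"
  have "r * f_fun m a K g \<ge> r * (m * \<bar>g\<bar> - 3 * a / 8 * m + g / 2 + K)"
    using h_fun_lower[OF a m, of g] r by (intro mult_left_mono) (auto simp: f_fun_def)
  moreover have "\<rho> * (g * h_slope m a g) \<ge> \<rho> * (m * (\<bar>g\<bar> - a) + g / 2)"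
    using slope_lower[OF a m] \<rho> by (intro mult_left_mono) auto
  moreover have "\<sigma>\<^sup>2 / 2 * h_curv m a g \<le> Q"
    unfolding Q_def using h_curv_bounds(2)[OF a m] by (intro mult_left_mono) auto
  moreover have "(r + \<rho>) * (m * \<bar>g\<bar> + g / 2) \<ge> (r + \<rho>) * ((m - 1 / 2) * \<bar>g\<bar>)"
    using r \<rho> by (intro mult_left_mono) (auto simp: algebra_simps)
  moreover have "(m + 1 / 2) * s * \<bar>g\<bar> \<le> (r + \<rho>) * (m - 1 / 2) * \<bar>g\<bar>"
    using dom by (intro mult_right_mono) auto
  moreover have "r * (m * \<bar>g\<bar> - 3 * a / 8 * m + g / 2 + K) + \<rho> * (m * (\<bar>g\<bar> - a) + g / 2)
      = (r + \<rho>) * (m * \<bar>g\<bar> + g / 2) + r * K - r * (3 * a / 8 * m) - \<rho> * (m * a)"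
    by (simp add: algebra_simps)
  moreover have "(r + \<rho>) * ((m - 1 / 2) * \<bar>g\<bar>) = (r + \<rho>) * (m - 1 / 2) * \<bar>g\<bar>"
    by simp
  ultimately show ?thesis
    using J K unfolding Q_def[symmetric] mult.assoc[of \<rho> g] by linarith
qed

lemma f_fun_odd_part: "f_fun m a K g - f_fun m a K (- g) = g"
  by (simp add: f_fun_def h_fun_def)

theorem theorem3p1:
  fixes T r \<rho> \<sigma> c L lam :: real
    and \<alpha> :: "real \<Rightarrow> real"
    and \<nu> :: "real measure"
    and \<gamma> :: "real \<Rightarrow> real \<Rightarrow> real"
  assumes "T > 0" and "r > 0" and "\<rho> \<ge> 0" and "\<sigma> > 0" and "c > 0"
    and "time_profile T \<alpha>"
    and "levy_measure \<nu>"
    and "emeasure \<nu> {z. \<bar>z\<bar> > 1} < \<infinity>"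
    and "lam = measure \<nu> {z. \<bar>z\<bar> > 1}"
    and "L > 0"
    and "admissible_jump \<nu> L \<gamma>"
    and "r + \<rho> > sqrt lam * L"
  shows "\<exists>m a K\<^sub>0. m > 1/2 \<and> a > 0 \<and> K\<^sub>0 > 0 \<and>
           C2_real (h_fun m a) \<and>
           (\<forall>K\<ge>K\<^sub>0.
              C2_real (f_fun m a K) \<and>
              (\<forall>g. \<forall>t\<in>{0..T}. \<alpha> t * f_fun m a K g \<ge> 0) \<and>
              viscosity_supersolution T r \<rho> \<sigma> \<nu> \<gamma> (payoff \<alpha> c) (\<lambda>g t. \<alpha> t * f_fun m a K g))"
proof -
  note prof = \<open>time_profile T \<alpha>\<close> and \<nu> = \<open>levy_measure \<nu>\<close>
  note \<alpha> = time_profile_facts[OF prof]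
  define s where "s = sqrt lam * L"
  have s: "0 \<le> s" "s < r + \<rho>"
    using assms(9,10,12) by (simp_all add: s_def)
  \<comment> \<open>As \<open>m\<close> grows, \<open>(m - 1/2) / (m + 1/2)\<close> tends to 1. The first summand is the value of \<open>m\<close> for which
    \<open>(m + 1/2) s = (r + \<rho>) (m - 1/2)\<close>, and adding 1 keeps \<open>m > 1/2\<close> also when \<open>s = 0\<close>.\<close>
  define m where "m = (r + \<rho> + s) / (2 * (r + \<rho> - s)) + 1"
  \<comment> \<open>Any positive \<open>a\<close> would do: it only enters the constants absorbed by \<open>K\<close>.\<close>
  define a :: real where "a = 1"
  have a: "a > 0" by (simp add: a_def)
  have "0 < (r + \<rho> + s) / (2 * (r + \<rho> - s))"
    using s by (intro divide_pos_pos) auto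
  then have m: "m > 1 / 2" "m \<ge> 0" "m \<ge> 1 / 2"
    unfolding m_def by linarith+
  have "(r + \<rho> - s) * m = (r + \<rho> + s) / 2 + (r + \<rho> - s)"
  proof -
    have "d * (n / (2 * d) + 1) = n / 2 + d" if "d \<noteq> 0" for d n :: real
      using that by (simp add: distrib_left)
    then show ?thesis
      unfolding m_def using s by (metis less_irrefl diff_gt_0_iff_gt)
  qed
  then have "(r + \<rho> - s) * m \<ge> (r + \<rho> + s) / 2"
    using s by linarith
  then have dom: "(m + 1 / 2) * s \<le> (r + \<rho>) * (m - 1 / 2)"
    by (simp add: field_simps)
  obtain C B where B: "\<And>g. integrable \<nu> (B g)" "\<And>g z. 0 \<le> B g z"
    "\<And>K g z. 0 < \<bar>z\<bar> \<Longrightarrow> \<bar>z\<bar> \<le> 1 \<Longrightarrow>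
       f_fun m a K (g + \<gamma> g z) - f_fun m a K g - \<gamma> g z * h_slope m a g \<le> B g z"
    "\<And>K g z. 1 < \<bar>z\<bar> \<Longrightarrow> f_fun m a K (g + \<gamma> g z) - f_fun m a K g \<le> B g z"
    "\<And>g. (\<integral>z. B g z \<partial>\<nu>) \<le> (m + 1 / 2) * s * \<bar>g\<bar> + C"
    using jump_part_domination[OF \<nu> assms(11) _ assms(8) a m(2), folded assms(9) s_def]
      \<open>L > 0\<close> by (metis less_eq_real_def)
  define K\<^sub>1 where "K\<^sub>1 = r * (3 * a / 8 * m) + \<rho> * (m * a) + \<sigma>\<^sup>2 / 2 * (3 * m / (2 * a)) + C"
  define K\<^sub>0 where "K\<^sub>0 = max (3 * a / 8 * m) (K\<^sub>1 / r)"
  have "0 < 3 * a / 8 * m"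
    using a m by simp
  then have K\<^sub>0: "K\<^sub>0 > 0"
    by (simp add: K\<^sub>0_def)
  have nonneg: "f_fun m a K g \<ge> 0" if "K \<ge> K\<^sub>0" for K g
    using f_fun_nonneg[OF a m(3)] that by (simp add: K\<^sub>0_def)
  have super: "viscosity_supersolution T r \<rho> \<sigma> \<nu> \<gamma> (payoff \<alpha> c) (\<lambda>g t. \<alpha> t * f_fun m a K g)"
    if K: "K \<ge> K\<^sub>0" for K
    unfolding viscosity_supersolution_def
  proof (intro conjI allI impI, goal_cases)
    case 1
    have "continuous_on UNIV (f_fun m a K)"
      using f_fun_deriv[OF a] DERIV_continuous_on by blast
    then show ?case
      using \<alpha>(1) by (rule separable_lsc[rotated])
  next
    case 2
    have "\<bar>f_fun m a K x\<bar> \<le> (m + 1 / 2 + K) * (\<bar>x\<bar> + 1)" for x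
    proof -
      have "\<bar>f_fun m a K x - K\<bar> \<le> (m + 1 / 2) * \<bar>x\<bar>"
        using f_fun_lipschitz[OF a m(2), of K x 0] by (simp add: f_fun_def h_fun_def a_def)
      moreover have "0 \<le> K * \<bar>x\<bar>"
        using K K\<^sub>0 by simp
      moreover have "(m + 1 / 2 + K) * (\<bar>x\<bar> + 1) = (m + 1 / 2) * \<bar>x\<bar> + K * \<bar>x\<bar> + (m + 1 / 2 + K)"
        by (simp add: distrib_left distrib_right)
      ultimately show ?thesis
        using K K\<^sub>0 m by linarith
    qed
    then show ?case
      using \<alpha>(1) K K\<^sub>0 m by (intro separable_linear_growth) auto
  next
    case (3 g)
    then show ?case by (simp add: \<alpha>(3))
  next
    case (4 \<phi> g\<^sub>0 t\<^sub>0 \<delta>)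
    then have \<phi>: "C21 T \<phi>" and t\<^sub>0: "t\<^sub>0 \<in> {0..<T}" and \<delta>: "0 < \<delta>" "\<delta> < 1"
      and touch: "\<And>g t. t \<in> {0..<T} \<Longrightarrow>
        \<alpha> t\<^sub>0 * f_fun m a K g\<^sub>0 - \<phi> g\<^sub>0 t\<^sub>0 \<le> \<alpha> t * f_fun m a K g - \<phi> g t"
      by auto
    have "r * K \<ge> r * (K\<^sub>1 / r)"
      using K \<open>r > 0\<close> by (intro mult_left_mono) (auto simp: K\<^sub>0_def)
    then have rK: "r * K \<ge> K\<^sub>1"
      using \<open>r > 0\<close> by simp
    have "split_op T r \<rho> \<sigma> \<nu> \<gamma> \<delta> \<phi> (\<lambda>g t. \<alpha> t * f_fun m a K g) g\<^sub>0 t\<^sub>0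
      \<le> \<alpha> t\<^sub>0 * (\<sigma>\<^sup>2 / 2 * h_curv m a g\<^sub>0 - \<rho> * g\<^sub>0 * h_slope m a g\<^sub>0 - r * f_fun m a K g\<^sub>0
          + (\<integral>z. B g\<^sub>0 z \<partial>\<nu>))"
      by (rule split_op_touching_le[where F = "f_fun m a K" and F' = "h_slope m a" and F'' = "h_curv m a"
            and \<phi> = \<phi> and \<alpha> = \<alpha> and \<gamma> = \<gamma> and t\<^sub>0 = t\<^sub>0 and g\<^sub>0 = g\<^sub>0 and B = "B g\<^sub>0",
            OF \<nu> prof \<phi> t\<^sub>0 \<delta> f_fun_deriv[OF a] h_slope_deriv[OF a] nonneg[OF K] touch B(1,2) B(3,4)])
    also have "\<dots> \<le> 0"
      using \<alpha>(2)[of t\<^sub>0] t\<^sub>0 assms(2,3) rK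
      by (intro mult_nonneg_nonpos stationary_inequality[OF a m(2) _ _ dom B(5)])
         (auto simp: K\<^sub>1_def)
    finally have "split_op T r \<rho> \<sigma> \<nu> \<gamma> \<delta> \<phi> (\<lambda>g t. \<alpha> t * f_fun m a K g) g\<^sub>0 t\<^sub>0 \<le> 0" .
    moreover have "\<alpha> t\<^sub>0 * f_fun m a K g\<^sub>0 - \<alpha> t\<^sub>0 * f_fun m a K (- g\<^sub>0) - payoff \<alpha> c g\<^sub>0 t\<^sub>0 = c"
      using f_fun_odd_part[of m a K g\<^sub>0]
      by (simp add: payoff_def right_diff_distrib[symmetric])
    ultimately show ?case
      using \<open>c > 0\<close> by simp
  qed
  show ?thesis
    using m(1) a K\<^sub>0 h_fun_C2[OF a] f_fun_C2[OF a] nonneg \<alpha>(2) super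
    by (intro exI[of _ m] exI[of _ a] exI[of _ K\<^sub>0]) simp
qed

end
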